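(* Let $G_{\bigtriangleup}$ be the infinite triangular grid. There exists a universal constant $c<1$ such that, whenever only finitely many vertices of $G_{\bigtriangleup}$ are burning, there exist a vertex $v_0\in V(G_{\bigtriangleup})$ and a strategy for two firefighters (protecting two vertices per turn) such that for every large enough $T$ all vertices burning after turn $T$ are contained in $N_{\le c\cdot T}(v_0)$.
   Context: $G_{\bigtriangleup}$ is the infinite 6-regular graph formed by the vertices and edges of the tiling of the plane by equilateral triangles. Firefighter process with two firefighters: in each turn, the firefighters first protect two vertices which are not yet on fire, and then the fire spreads to all unprotected neighbors of the vertices already on fire. Once a vertex is on fire or is protected it stays in that state forever. Here the process starts from an arbitrary position in which finitely many vertices are burning; the constant $c$ does not depend on this position, while $v_0$, the strategy and how large $T$ has to be may depend on it. $N_{\le t}(v)=\{x\in V(G): d_G(x,v)\le t\}$, where $d_G$ is the graph distance. *)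

theory Defs
  imports Complex_Main
begin

text \<open>A graph is given by its adjacency relation on a type of vertices.\<close>

text \<open>Length of a shortest walk; meaningful only for vertices in the same component.\<close>

definition graph_dist :: "('v \<Rightarrow> 'v \<Rightarrow> bool) \<Rightarrow> 'v \<Rightarrow> 'v \<Rightarrow> nat" where
  "graph_dist E u v = (LEAST n. (E ^^ n) u v)"

definition nbhd_le :: "('v \<Rightarrow> 'v \<Rightarrow> bool) \<Rightarrow> real \<Rightarrow> 'v \<Rightarrow> 'v set" where
  "nbhd_le E r v = {x. real (graph_dist E x v) \<le> r}"

text \<open>The spread of fire is deterministic, so a strategy against a given initial fire is just a
  sequence of sets: \<open>\<sigma> t\<close> is protected in turn \<open>t + 1\<close>, before the fire spreads in that turn.
  \<open>burning E \<sigma> B t\<close> is the set of vertices on fire after turn \<open>t\<close>.\<close>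

fun burning :: "('v \<Rightarrow> 'v \<Rightarrow> bool) \<Rightarrow> (nat \<Rightarrow> 'v set) \<Rightarrow> 'v set \<Rightarrow> nat \<Rightarrow> 'v set" where
  "burning E \<sigma> B 0 = B"
| "burning E \<sigma> B (Suc t) =
     burning E \<sigma> B t \<union> {v. (\<exists>u\<in>burning E \<sigma> B t. E u v) \<and> v \<notin> (\<Union>s\<le>t. \<sigma> s)}"

definition firefighter_strategy ::
  "('v \<Rightarrow> 'v \<Rightarrow> bool) \<Rightarrow> nat \<Rightarrow> 'v set \<Rightarrow> (nat \<Rightarrow> 'v set) \<Rightarrow> bool" where
  "firefighter_strategy E k B \<sigma> \<longleftrightarrow>
     (\<forall>t. finite (\<sigma> t) \<and> card (\<sigma> t) = k \<and> \<sigma> t \<inter> burning E \<sigma> B t = {})"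

text \<open>The pair \<open>(a, b)\<close> stands for the point \<open>a + b \<omega>\<close> of the plane, where
  \<open>\<omega> = exp (i pi / 3)\<close>.\<close>

definition tri_point :: "int \<times> int \<Rightarrow> complex" where
  "tri_point p = Complex (of_int (fst p) + of_int (snd p) / 2) (of_int (snd p) * sqrt 3 / 2)"

definition tri_adj :: "int \<times> int \<Rightarrow> int \<times> int \<Rightarrow> bool" where
  "tri_adj p q \<longleftrightarrow> (fst q - fst p, snd q - snd p) \<in>
     {(1, 0), (-1, 0), (0, 1), (0, -1), (1, -1), (-1, 1)}"

text \<open>The edges are exactly the unit segments of the tiling by triangles of side 1.\<close>

lemma tri_adj_iff_dist: "tri_adj p q \<longleftrightarrow> dist (tri_point p) (tri_point q) = 1"
proof -
  define a where "a = fst q - fst p"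
  define b where "b = snd q - snd p"
  have "(dist (tri_point p) (tri_point q))\<^sup>2 = (of_int a + of_int b / 2)\<^sup>2 + (of_int b * sqrt 3 / 2)\<^sup>2"
    by (subst dist_commute)
      (simp add: dist_norm cmod_power2 tri_point_def a_def b_def diff_divide_distrib left_diff_distrib
        add_diff_add)
  also have "\<dots> = of_int (a * a + a * b + b * b)"
    by (simp add: power2_eq_square field_simps)
  finally have d: "(dist (tri_point p) (tri_point q))\<^sup>2 = of_int (a * a + a * b + b * b)" .
  have "dist (tri_point p) (tri_point q) = 1 \<longleftrightarrow> (dist (tri_point p) (tri_point q))\<^sup>2 = 1"
    by (smt (verit) one_power2 power2_eq_1_iff zero_le_dist)
  also have "\<dots> \<longleftrightarrow> a * a + a * b + b * b = 1"
    unfolding d by linarith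
  also have "\<dots> \<longleftrightarrow> (a, b) \<in> {(1, 0), (-1, 0), (0, 1), (0, -1), (1, -1), (-1, 1)}"
  proof
    assume h: "a * a + a * b + b * b = 1"
    have "(2 * a + b)\<^sup>2 + 3 * b\<^sup>2 = 4" "(2 * b + a)\<^sup>2 + 3 * a\<^sup>2 = 4"
      using h by (simp_all add: power2_eq_square algebra_simps)
    then have "b\<^sup>2 < 4" "a\<^sup>2 < 4"
      using zero_le_power2[of "2 * a + b"] zero_le_power2[of "2 * b + a"] by linarith+
    then have "\<bar>a\<bar> < 2" "\<bar>b\<bar> < 2"
      using power2_less_imp_less[of "\<bar>a\<bar>" 2] power2_less_imp_less[of "\<bar>b\<bar>" 2] by simp_all
    then have "a \<in> {-1, 0, 1}" "b \<in> {-1, 0, 1}" by auto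
    then show "(a, b) \<in> {(1, 0), (-1, 0), (0, 1), (0, -1), (1, -1), (-1, 1)}"
      using h by auto
  qed auto
  finally show ?thesis
    unfolding tri_adj_def a_def b_def by simp
qed

text \<open>The grid is connected, so \<open>graph_dist tri_adj\<close> is the true distance everywhere.\<close>

lemma tri_connected: "\<exists>n. (tri_adj ^^ n) p q"
proof -
  have x: "tri_adj\<^sup>*\<^sup>* (a, b) (a + int k, b)" "tri_adj\<^sup>*\<^sup>* (a, b) (a - int k, b)"
    and y: "tri_adj\<^sup>*\<^sup>* (a, b) (a, b + int k)" "tri_adj\<^sup>*\<^sup>* (a, b) (a, b - int k)" for a b k
    by (induction k; auto simp: tri_adj_def elim!: rtranclp.rtrancl_into_rtrancl)+
  obtain a b c d where pq: "p = (a, b)" "q = (c, d)" by (metis prod.exhaust)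
  have "tri_adj\<^sup>*\<^sup>* (a, b) (c, b)"
    using x(1)[of a b "nat (c - a)"] x(2)[of a b "nat (a - c)"] by (cases "a \<le> c") auto
  moreover have "tri_adj\<^sup>*\<^sup>* (c, b) (c, d)"
    using y(1)[of c b "nat (d - b)"] y(2)[of c b "nat (b - d)"] by (cases "b \<le> d") auto
  ultimately show ?thesis
    unfolding pq by (meson rtranclp_imp_relpowp rtranclp_trans)
qed

end

theory Submission
  imports Defs
begin

text \<open>
  Without any protection the fire fills, after \<open>T\<close> turns, a regular hexagon whose six sides each
  move outwards by \<open>1\<close> per turn. No side can ever move faster, so once a side lags behind its
  unobstructed position by some amount, it lags by at least this amount forever. It is therefore
  enough to hold up the six sides one after the other, each for a constant fraction of the time
  that has passed, over and over again.

  One side can be held up as follows. Call a turn number, increased by the radius \<open>R\<close> of a hexagon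
  around the initial fire, the age of the fire; at age \<open>s\<close> the fire lies in the hexagon of radius
  \<open>s\<close>. From age \<open>t\<close> on, guard the line that supports the hexagon of radius \<open>2t + 1\<close> on the chosen
  side, beginning at the midpoint and adding one vertex at each end in each turn. At age \<open>s\<close> the
  guarded segment has \<open>2(s - t)\<close> vertices, whereas the hexagon of radius \<open>s\<close> meets that line
  in \<open>2s - (2t + 1) + 1 = 2(s - t)\<close> vertices, if at all. The two segments coincide, so two
  firefighters are exactly fast enough never to let the fire cross the line (lemma
  \<open>side_held_during_phase\<close>). At age \<open>3t\<close> that side is still at distance at most \<open>2t\<close>: it lags
  by \<open>t\<close>.

  Phase \<open>k\<close> covers the ages from \<open>3\<^sup>k\<close> to \<open>3\<^sup>k\<^sup>+\<^sup>1\<close> and holds up side \<open>k\<close> modulo \<open>6\<close>. At an age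
  \<open>s\<close> in phase \<open>k\<close> the last six completed phases have dealt with all sides, and the earliest of
  them produced a lag of \<open>3\<^sup>k\<^sup>-\<^sup>6 > s / 3\<^sup>7\<close>. So the fire is inside the hexagon of radius
  \<open>(1 - 3\<^sup>-\<^sup>7) s\<close>, and the constant difference between age and turn number is absorbed by a
  slightly larger factor.\<close>

section \<open>Hexagonal geometry of the grid\<close>

text \<open>Multiplication by \<open>\<omega>\<close>, that is, rotation about the origin by 60 degrees.\<close>

definition rot :: "int \<times> int \<Rightarrow> int \<times> int" where
  "rot v = (- snd v, fst v + snd v)"

text \<open>A side of the hexagon of radius \<open>r\<close> lies on the line \<open>height v = r\<close>; the other sides
  are its preimages under the powers of \<open>rot\<close>.\<close>

definition height :: "int \<times> int \<Rightarrow> int" where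
  "height v = fst v + snd v"

text \<open>A closed form of the graph distance from the origin. Its balls are the hexagons.\<close>

definition hex_norm :: "int \<times> int \<Rightarrow> int" where
  "hex_norm v = max \<bar>fst v\<bar> (max \<bar>snd v\<bar> \<bar>fst v + snd v\<bar>)"

lemma bij_rot: "bij rot"
  by (rule o_bij[of "\<lambda>v. (fst v + snd v, - fst v)"]) (auto simp: rot_def fun_eq_iff)

lemma bij_rot_pow: "bij (rot ^^ k)"
  by (rule bij_fn[OF bij_rot])

lemma hex_norm_le_iff:
  "hex_norm (a, b) \<le> m \<longleftrightarrow>
     a \<le> m \<and> - a \<le> m \<and> b \<le> m \<and> - b \<le> m \<and> a + b \<le> m \<and> - (a + b) \<le> m"
  by (simp add: hex_norm_def abs_le_iff conj_ac)

lemma hex_norm_rot: "hex_norm (rot v) = hex_norm v"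
  by (simp add: hex_norm_def rot_def max.left_commute max.commute)

lemma hex_norm_rot_pow: "hex_norm ((rot ^^ k) v) = hex_norm v"
  by (induction k) (simp_all add: hex_norm_rot)

lemma tri_adj_rot: "tri_adj u v \<Longrightarrow> tri_adj (rot u) (rot v)"
proof -
  assume "tri_adj u v"
  moreover have "fst (rot v) - fst (rot u) = - (snd v - snd u)"
    "snd (rot v) - snd (rot u) = (fst v - fst u) + (snd v - snd u)"
    by (simp_all add: rot_def)
  ultimately show ?thesis
    unfolding tri_adj_def by (elim insertE) (simp_all del: diff_eq_eq add: prod_eq_iff)
qed

lemma tri_adj_rot_pow: "tri_adj u v \<Longrightarrow> tri_adj ((rot ^^ k) u) ((rot ^^ k) v)"
  by (induction k) (simp_all add: tri_adj_rot)

lemma height_le_hex_norm: "height v \<le> hex_norm v"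
  by (simp add: height_def hex_norm_def)

lemma hex_norm_le_iff_heights: "hex_norm v \<le> m \<longleftrightarrow> (\<forall>i<6. height ((rot ^^ i) v) \<le> m)"
proof -
  obtain a b where v: "v = (a, b)" by fastforce
  have "(\<forall>i<6. P i) \<longleftrightarrow> P 0 \<and> P 1 \<and> P 2 \<and> P 3 \<and> P 4 \<and> P 5" for P :: "nat \<Rightarrow> bool"
    by (simp add: eval_nat_numeral All_less_Suc conj_ac)
  then show ?thesis
    unfolding v hex_norm_le_iff
    by (simp add: height_def rot_def eval_nat_numeral) argo
qed

lemma height_rot_pow_adj:
  assumes "tri_adj u v"
  shows "height ((rot ^^ k) v) \<le> height ((rot ^^ k) u) + 1"
proof -
  have "height v \<le> height u + 1" if "tri_adj u v" for u v
  proof -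
    have "(fst v - fst u) + (snd v - snd u) \<le> 1"
      using that unfolding tri_adj_def by (elim insertE) simp_all
    then show ?thesis by (simp add: height_def)
  qed
  then show ?thesis using tri_adj_rot_pow[OF assms] .
qed

lemma hex_norm_adj:
  assumes "tri_adj u v"
  shows "hex_norm v \<le> hex_norm u + 1"
  unfolding hex_norm_le_iff_heights
  using height_rot_pow_adj[OF assms] height_le_hex_norm hex_norm_rot_pow
  by (metis add_right_mono order_trans)

text \<open>The six directions \<open>\<plusminus>1\<close>, \<open>\<plusminus>\<omega>\<close>, \<open>\<plusminus>(1 - \<omega>)\<close> cut the plane into six sectors. Every point is a
  non-negative combination of the two directions that bound its sector, and going back along one
  that occurs in it brings the point closer to the origin.\<close>

lemma hex_norm_descent:
  assumes "hex_norm v \<le> int (Suc n)" "v \<noteq> (0, 0)"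
  shows "\<exists>u. tri_adj v u \<and> hex_norm u \<le> int n"
proof -
  obtain a b where v: "v = (a, b)" by fastforce
  note ab = assms[unfolded v hex_norm_le_iff]
  consider "a > 0" "b < 0" | "a < 0" "b > 0" | "a > 0" "b \<ge> 0" | "a < 0" "b \<le> 0"
    | "a = 0" "b > 0" | "a = 0" "b < 0"
    using ab(2) by fastforce
  then show ?thesis
  proof cases
    case 1
    with ab show ?thesis
      by (intro exI[of _ "(a - 1, b + 1)"]) (simp add: v tri_adj_def hex_norm_le_iff)
  next
    case 2
    with ab show ?thesis
      by (intro exI[of _ "(a + 1, b - 1)"]) (simp add: v tri_adj_def hex_norm_le_iff)
  next
    case 3
    with ab show ?thesis
      by (intro exI[of _ "(a - 1, b)"]) (simp add: v tri_adj_def hex_norm_le_iff)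
  next
    case 4
    with ab show ?thesis
      by (intro exI[of _ "(a + 1, b)"]) (simp add: v tri_adj_def hex_norm_le_iff)
  next
    case 5
    with ab show ?thesis
      by (intro exI[of _ "(a, b - 1)"]) (simp add: v tri_adj_def hex_norm_le_iff)
  next
    case 6
    with ab show ?thesis
      by (intro exI[of _ "(a, b + 1)"]) (simp add: v tri_adj_def hex_norm_le_iff)
  qed
qed

lemma walk_to_origin:
  "hex_norm v \<le> int n \<Longrightarrow> \<exists>m\<le>n. (tri_adj ^^ m) v (0, 0)"
proof (induction n arbitrary: v)
  case 0
  then have "v = (0, 0)" by (auto simp: hex_norm_def prod_eq_iff)
  then show ?case by auto
next
  case (Suc n)
  show ?case
  proof (cases "v = (0, 0)")
    case True
    then show ?thesis by (intro exI[of _ 0]) auto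
  next
    case False
    with Suc.prems obtain u where u: "tri_adj v u" "hex_norm u \<le> int n"
      using hex_norm_descent by blast
    with Suc.IH obtain m where "m \<le> n" "(tri_adj ^^ m) u (0, 0)" by blast
    with u(1) have "Suc m \<le> Suc n" "(tri_adj ^^ Suc m) v (0, 0)"
      by - (simp, rule relpowp_Suc_I2)
    then show ?thesis by blast
  qed
qed

lemma graph_dist_le_hex_norm: "int (graph_dist tri_adj v (0, 0)) \<le> hex_norm v"
proof -
  have "hex_norm v \<ge> 0" by (auto simp: hex_norm_def)
  then obtain m where "m \<le> nat (hex_norm v)" "(tri_adj ^^ m) v (0, 0)"
    using walk_to_origin[of v "nat (hex_norm v)"] by auto
  then have "graph_dist tri_adj v (0, 0) \<le> m"
    unfolding graph_dist_def by (intro Least_le)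
  with \<open>m \<le> _\<close> \<open>hex_norm v \<ge> 0\<close> show ?thesis by linarith
qed

lemma finite_subset_hexagon:
  assumes "finite B"
  shows "\<exists>R\<ge>1. \<forall>v\<in>B. hex_norm v \<le> int R"
proof -
  obtain m where m: "\<forall>v\<in>B. hex_norm v \<le> m"
    using bdd_above_finite[OF finite_imageI[OF assms, of hex_norm]] by (auto simp: bdd_above_def)
  then have "\<forall>v\<in>B. hex_norm v \<le> int (nat (max m 1))" by (auto simp: le_max_iff_disj)
  moreover have "nat (max m 1) \<ge> 1" by auto
  ultimately show ?thesis by blast
qed

section \<open>The strategy\<close>

definition phase :: "nat \<Rightarrow> nat" where
  "phase s = (LEAST k. s < 3 ^ Suc k)"

lemma phase_eqI:
  assumes "3 ^ k \<le> s" "s < 3 ^ Suc k"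
  shows "phase s = k"
  unfolding phase_def
proof (rule Least_equality)
  fix j assume "s < 3 ^ Suc j"
  with assms(1) have "(3::nat) ^ k < 3 ^ Suc j" by linarith
  then show "k \<le> j" using power_less_imp_less_exp[of "3::nat" k "Suc j"] by simp
qed (use assms in simp)

lemma phase_bounds:
  assumes "s \<ge> 1"
  shows "3 ^ phase s \<le> s" "s < 3 ^ Suc (phase s)"
proof -
  have "s < 3 ^ s" by (induction s) auto
  also have "(3::nat) ^ s \<le> 3 ^ Suc s" by simp
  finally show "s < 3 ^ Suc (phase s)"
    unfolding phase_def by (rule LeastI)
  show "3 ^ phase s \<le> s"
  proof (cases "phase s")
    case 0
    with assms show ?thesis by simp
  next
    case (Suc k)
    then have "\<not> s < 3 ^ Suc k"
      unfolding phase_def using not_less_Least[of k "\<lambda>k. s < 3 ^ Suc k"] by simp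
    with Suc show ?thesis by simp
  qed
qed

text \<open>The two vertices protected at age \<open>s\<close>. Before the rotation they are symmetric points of
  the line \<open>height v = 2 * 3 ^ k + 1\<close>, and \<open>s + 1\<close> as a coordinate puts them just outside the
  hexagon of radius \<open>s\<close>. So they cannot be burning yet, whatever has been protected before.\<close>

definition guards :: "nat \<Rightarrow> (int \<times> int) set" where
  "guards s = (let k = phase s; x = 2 * 3 ^ k - int s; y = int s + 1
     in (rot ^^ k) -` {(x, y), (y, x)})"

lemma guards_two:
  assumes "s \<ge> 1"
  shows "finite (guards s)" "card (guards s) = 2"
proof -
  define k where "k = phase s"
  have "int (3 ^ k) \<le> int s"
    using phase_bounds(1)[OF assms] unfolding k_def by (rule zle_int[THEN iffD2])
  then have "2 * 3 ^ k - int s \<noteq> int s + 1" unfolding of_nat_power of_nat_numeral by linarith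
  then have "card {(2 * 3 ^ k - int s, int s + 1), (int s + 1, 2 * 3 ^ k - int s)} = 2"
    by simp
  then show "card (guards s) = 2"
    unfolding guards_def Let_def k_def
    using bij_rot_pow by (subst card_vimage_inj) (auto simp: bij_def)
  then show "finite (guards s)"
    using card.infinite by fastforce
qed

lemma guards_outside_hexagon: "v \<in> guards s \<Longrightarrow> hex_norm v > int s"
proof -
  assume "v \<in> guards s"
  then have "int s < hex_norm ((rot ^^ phase s) v)"
    unfolding guards_def Let_def by (elim vimageE insertE) (simp_all add: hex_norm_def)
  then show ?thesis by (simp add: hex_norm_rot_pow)
qed

text \<open>A point whose larger coordinate is \<open>z\<close> is guarded at age \<open>z - 1\<close>, and the hexagon of radius
  \<open>s + 1\<close>, which bounds the next spread of the fire, only contains points with \<open>z \<le> s + 1\<close>. The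
  larger coordinate of a point on the line exceeds \<open>3 ^ k\<close>, so that its age falls into phase
  \<open>k\<close>.\<close>

lemma guards_cover_line:
  assumes "3 ^ k \<le> s" "s < 3 ^ Suc k"
    and "hex_norm v \<le> int s + 1" "height ((rot ^^ k) v) = 2 * 3 ^ k + 1"
  shows "\<exists>s'\<ge>3 ^ k. s' \<le> s \<and> v \<in> guards s'"
proof -
  obtain x y where xy: "(rot ^^ k) v = (x, y)" by fastforce
  have sum: "x + y = 2 * 3 ^ k + 1"
    using assms(4) xy by (simp add: height_def)
  have "x \<le> int s + 1" "y \<le> int s + 1"
    using assms(3) hex_norm_rot_pow[of k v] hex_norm_le_iff[of x y] xy by auto
  define s' where "s' = nat (max x y - 1)"
  have "max x y \<ge> 3 ^ k + 1" using sum by linarith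
  moreover have "(0::int) < 3 ^ k" by simp
  ultimately have "max x y - 1 \<ge> 0" by linarith
  then have s'_eq: "int s' = max x y - 1" by (simp add: s'_def)
  with \<open>max x y \<ge> 3 ^ k + 1\<close> have "int (3 ^ k) \<le> int s'"
    unfolding of_nat_power of_nat_numeral by linarith
  then have "s' \<ge> 3 ^ k" by (rule zle_int[THEN iffD1])
  moreover have "s' \<le> s"
    using s'_eq \<open>x \<le> _\<close> \<open>y \<le> _\<close> by linarith
  moreover have "phase s' = k"
    using calculation assms(2) by (intro phase_eqI) auto
  then have "v \<in> guards s'"
    using s'_eq sum xy by (cases "x \<ge> y") (simp_all add: guards_def Let_def)
  ultimately show ?thesis by blast
qed

section \<open>The lag of the fire\<close>

context
  fixes B :: "(int \<times> int) set" and R :: nat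
  assumes R: "R \<ge> 1" and B: "\<And>v. v \<in> B \<Longrightarrow> hex_norm v \<le> int R"
begin

abbreviation fire :: "nat \<Rightarrow> (int \<times> int) set" where
  "fire T \<equiv> burning tri_adj (\<lambda>T. guards (T + R)) B T"

lemma fire_in_hexagon: "v \<in> fire T \<Longrightarrow> hex_norm v \<le> int (T + R)"
proof (induction T arbitrary: v)
  case 0
  then show ?case using B by simp
next
  case (Suc T)
  show ?case
  proof (cases "v \<in> fire T")
    case True
    then show ?thesis using Suc.IH[of v] by simp
  next
    case False
    then obtain u where "u \<in> fire T" "tri_adj u v" using Suc.prems by auto
    then show ?thesis using Suc.IH[of u] hex_norm_adj[of u v] by simp
  qed
qed

lemma guards_strategy: "firefighter_strategy tri_adj 2 B (\<lambda>T. guards (T + R))"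
  unfolding firefighter_strategy_def
proof (intro allI conjI)
  fix T
  show "finite (guards (T + R))" "card (guards (T + R)) = 2"
    using guards_two[of "T + R"] R by simp_all
  show "guards (T + R) \<inter> fire T = {}"
    using guards_outside_hexagon[of _ "T + R"] fire_in_hexagon[of _ T] by (meson disjoint_iff not_less)
qed

text \<open>Heights change by at most \<open>1\<close> along an edge, so the fire can only pass the line by burning
  one of its points; but each of these is protected before the fire can reach it.\<close>

lemma side_held_during_phase:
  assumes "R \<le> 3 ^ k" "3 ^ k \<le> T + R" "T + R \<le> 3 ^ Suc k" "v \<in> fire T"
  shows "height ((rot ^^ k) v) \<le> 2 * 3 ^ k"
proof -
  have inside: "height ((rot ^^ k) v) \<le> 2 * 3 ^ k" if "hex_norm v \<le> int (3 ^ k)" for v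
  proof -
    have "height ((rot ^^ k) v) \<le> 3 ^ k"
      using height_le_hex_norm[of "(rot ^^ k) v"] that by (simp add: hex_norm_rot_pow)
    moreover have "(0::int) < 3 ^ k" by simp
    ultimately show ?thesis by linarith
  qed
  show ?thesis
    using assms(2-)
  proof (induction T arbitrary: v)
    case 0
    then have "hex_norm v \<le> int (3 ^ k)"
      using fire_in_hexagon[of v 0] assms(1) by (metis add_0 le_antisym)
    then show ?case by (rule inside)
  next
    case (Suc T)
    show ?case
    proof (cases "3 ^ k = Suc T + R")
      case True
      then have "hex_norm v \<le> int (3 ^ k)"
        using fire_in_hexagon[OF Suc.prems(3)] by simp
      then show ?thesis by (rule inside)
    next
      case False
      then have T: "3 ^ k \<le> T + R" "T + R < 3 ^ Suc k" using Suc.prems by auto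
      then have IH: "\<And>u. u \<in> fire T \<Longrightarrow> height ((rot ^^ k) u) \<le> 2 * 3 ^ k"
        using Suc.IH by simp
      show ?thesis
      proof (cases "v \<in> fire T")
        case True
        then show ?thesis by (rule IH)
      next
        case new: False
        then obtain u where u: "u \<in> fire T" "tri_adj u v"
          and unguarded: "\<And>t. t \<le> T \<Longrightarrow> v \<notin> guards (t + R)"
          using Suc.prems(3) by auto
        show ?thesis
        proof (rule ccontr)
          assume "\<not> ?thesis"
          with height_rot_pow_adj[OF u(2), of k] IH[OF u(1)]
          have "height ((rot ^^ k) v) = 2 * 3 ^ k + 1" by linarith
          moreover have "hex_norm v \<le> int (T + R) + 1"
            using fire_in_hexagon[OF Suc.prems(3)] by simp
          ultimately obtain s where s: "3 ^ k \<le> s" "s \<le> T + R" "v \<in> guards s"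
            using guards_cover_line[OF T] by blast
          \<comment> \<open>The covering guard was posted at an age of at least \<open>R\<close>, hence in an actual turn.\<close>
          with assms(1) have "s - R \<le> T" "s - R + R = s" by auto
          with unguarded[of "s - R"] s(3) show False by simp
        qed
      qed
    qed
  qed
qed

text \<open>At the end of the phase the lag is at least \<open>3 ^ Suc k - 2 * 3 ^ k = 3 ^ k\<close>, and it never
  decreases because heights grow by at most \<open>1\<close> per turn.\<close>

lemma side_lags_after_phase:
  assumes "R \<le> 3 ^ k" "3 ^ Suc k \<le> T + R" "v \<in> fire T"
  shows "height ((rot ^^ k) v) \<le> int (T + R) - 3 ^ k"
proof -
  define T1 where "T1 = 3 ^ Suc k - R"
  have T1: "T1 + R = 3 ^ Suc k" using assms(1) by (simp add: T1_def)
  then have "int T1 + int R = 3 * 3 ^ k"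
    by (metis of_nat_add of_nat_numeral of_nat_power power_Suc)
  then have at_end: "height ((rot ^^ k) v) \<le> int (T1 + R) - 3 ^ k" if "v \<in> fire T1" for v
    using side_held_during_phase[OF assms(1) _ _ that] T1 by simp
  have "T1 \<le> T" using assms(2) T1 by linarith
  then show ?thesis
    using assms(3)
  proof (induction T arbitrary: v rule: dec_induct)
    case base
    then show ?case by (rule at_end)
  next
    case (step T)
    show ?case
    proof (cases "v \<in> fire T")
      case True
      then show ?thesis using step.IH[of v] by simp
    next
      case False
      then obtain u where "u \<in> fire T" "tri_adj u v" using step.prems by auto
      then show ?thesis using step.IH[of u] height_rot_pow_adj[of u v k] by simp
    qed
  qed
qed

text \<open>The six phases preceding the current one have treated six consecutive, hence all, sides.
  The lower bound on \<open>T\<close> ensures that even the earliest of them began at an age of at least \<open>R\<close>,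
  so that it was played in full.\<close>

lemma fire_in_slow_hexagon:
  assumes "2187 * R \<le> T + R" "v \<in> fire T"
  shows "2187 * hex_norm v \<le> 2186 * int (T + R)"
proof -
  define s k where "s = T + R" and "k = phase s"
  have s: "3 ^ k \<le> s" "s < 3 ^ Suc k"
    using phase_bounds[of s] R unfolding k_def s_def by auto
  have "(3::nat) ^ 7 < 3 ^ Suc k"
    using s(2) assms(1) R unfolding s_def by simp
  then have "7 < Suc k" using power_less_imp_less_exp[of "3::nat" 7 "Suc k"] by simp
  then obtain q where q: "k = q + 6"
    using le_Suc_ex[of 6 k] by auto
  have sq: "s < 2187 * 3 ^ q" using s(2) by (simp add: q power_add)
  then have R_q: "R \<le> 3 ^ q" using assms(1) unfolding s_def by linarith
  have "height ((rot ^^ i) ((rot ^^ q) v)) \<le> int s - 3 ^ q" if "i < 6" for i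
  proof -
    have le: "(3::nat) ^ q \<le> 3 ^ (i + q)" "(3::int) ^ q \<le> 3 ^ (i + q)"
      by (auto intro: power_increasing)
    have "(3::nat) ^ Suc (i + q) \<le> 3 ^ k"
      using that q by (intro power_increasing) auto
    then have "3 ^ Suc (i + q) \<le> T + R" using s(1) unfolding s_def by linarith
    with order_trans[OF R_q le(1)] have "height ((rot ^^ (i + q)) v) \<le> int s - 3 ^ (i + q)"
      unfolding s_def by (rule side_lags_after_phase[OF _ _ assms(2)])
    with le(2) have "height ((rot ^^ (i + q)) v) \<le> int s - 3 ^ q" by linarith
    then show ?thesis by (simp add: funpow_add)
  qed
  then have "hex_norm v \<le> int s - 3 ^ q"
    using hex_norm_le_iff_heights[of "(rot ^^ q) v"] by (simp add: hex_norm_rot_pow)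
  moreover have "int s < 2187 * 3 ^ q"
    using sq by (metis of_nat_less_iff of_nat_mult of_nat_numeral of_nat_power)
  ultimately have "2187 * hex_norm v \<le> 2186 * int s" by linarith
  then show ?thesis by (simp add: s_def)
qed

end

theorem theorem6:
  "\<exists>c::real. c < 1 \<and>
     (\<forall>B :: (int \<times> int) set. finite B \<longrightarrow>
       (\<exists>v0 \<sigma>. firefighter_strategy tri_adj 2 B \<sigma> \<and>
         (\<exists>T0. \<forall>T\<ge>T0. burning tri_adj \<sigma> B T \<subseteq> nbhd_le tri_adj (c * real T) v0)))"
proof (intro exI[of _ "4373 / 4374 :: real"] conjI allI impI)
  fix B :: "(int \<times> int) set"
  assume "finite B"
  then obtain R where R: "R \<ge> 1" "\<And>v. v \<in> B \<Longrightarrow> hex_norm v \<le> int R"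
    using finite_subset_hexagon[of B] by auto
  let ?\<sigma> = "\<lambda>T. guards (T + R)"
  \<comment> \<open>From turn \<open>4374 * R\<close> on, half of the lag \<open>(T + R) / 2187\<close> makes up for the difference \<open>R\<close>
    between age and turn number.\<close>
  have "burning tri_adj ?\<sigma> B T \<subseteq> nbhd_le tri_adj (4373 / 4374 * real T) (0, 0)"
    if T: "T \<ge> 4374 * R" for T
  proof
    fix v assume "v \<in> burning tri_adj ?\<sigma> B T"
    moreover have "2187 * R \<le> T + R" using T by linarith
    ultimately have "2187 * hex_norm v \<le> 2186 * int (T + R)"
      using fire_in_slow_hexagon[OF R] by blast
    moreover have "4374 * int R \<le> int T"
      using T by (metis of_nat_le_iff of_nat_mult of_nat_numeral)
    moreover have "0 \<le> int R" by simp
    ultimately have "4374 * int (graph_dist tri_adj v (0, 0)) \<le> 4373 * int T"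
      using graph_dist_le_hex_norm[of v] unfolding of_nat_add distrib_left by linarith
    then have "real_of_int (4374 * int (graph_dist tri_adj v (0, 0))) \<le> real_of_int (4373 * int T)"
      by (rule of_int_le_iff[THEN iffD2])
    then show "v \<in> nbhd_le tri_adj (4373 / 4374 * real T) (0, 0)"
      by (simp add: nbhd_le_def)
  qed
  then show "\<exists>v0 \<sigma>. firefighter_strategy tri_adj 2 B \<sigma> \<and>
      (\<exists>T0. \<forall>T\<ge>T0. burning tri_adj \<sigma> B T \<subseteq> nbhd_le tri_adj (4373 / 4374 * real T) v0)"
    using guards_strategy[OF R] by blast
qed simp

end
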